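(* Let $G=(V,E)$ be a finite simple graph with at least one edge and let $t=\operatorname{Xind}(\operatorname{Hom}(K_2,G))+2$. Let $M$ be a matroid and let $(x_v)_{v\in V}$ be an independent representation of $G$ over $M$. Then $G$ contains a complete bipartite subgraph $K_{\lfloor t/2\rfloor,\lceil t/2\rceil}$ such that the elements assigned to the vertices of each side are independent in $M$; that is, there are disjoint sets $X^*,Y^*\subseteq V$ with $|X^*|=\lfloor t/2\rfloor$ and $|Y^*|=\lceil t/2\rceil$ such that every vertex of $X^*$ is adjacent in $G$ to every vertex of $Y^*$, and each of the families $(x_v)_{v\in X^*}$ and $(x_v)_{v\in Y^*}$ is independent in $M$. In particular, $\operatorname{rk} M\geq \frac12\operatorname{Xind}(\operatorname{Hom}(K_2,G))+2$.
   Context: Independent representation: given a graph $G=(V,E)$ and a matroid $M$, an independent representation of $G$ over $M$ is an assignment of an element $x_v\in M$ to each vertex $v\in V$ such that $x_v\notin\operatorname{span}(\{x_u : u\in N(v)\})$ for every $v\in V$, where $N(v)$ is the set of neighbors of $v$ and $\operatorname{span}$ is the matroid closure. Different vertices may receive the same element. A family $(x_v)_{v\in U}$ is independent if its members are pairwise distinct and form an independent set of $M$. Matroids have finite rank, but linear matroids formed by all the vectors of a finite-dimensional vector space (possibly with infinite ground set) are allowed. $\operatorname{rk} M$ is the rank of $M$. Free $Z_2$-posets and cross-index: a free $Z_2$-poset is a poset with a fixed-point free involution $\nu$ that preserves the order. A map $\phi\colon P\to Q$ between free $Z_2$-posets is an order-preserving $Z_2$-map if it is order-preserving and $\phi(\nu\cdot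 p)=\nu\cdot\phi(p)$ for all $p\in P$. For an integer $n\ge 0$, $Q_n$ is the free $Z_2$-poset with elements $\{\pm1,\ldots,\pm(n+1)\}$, strict order given by $p<q$ if and only if $|p|<|q|$ (so $-i$ and $+i$ are incomparable), and involution $p\mapsto -p$. The cross-index $\operatorname{Xind}(P)$ of a nonempty free $Z_2$-poset $P$ is the minimum $n\geq 0$ such that there is an order-preserving $Z_2$-map from $P$ to $Q_n$; by convention $\operatorname{Xind}(\emptyset)=-1$. Hom complex: for a graph $G=(V,E)$, $\operatorname{Hom}(K_2,G)$ is the free $Z_2$-poset of all pairs $(X,Y)$ of nonempty disjoint subsets of $V$ such that every vertex of $X$ is adjacent to every vertex of $Y$, ordered by $(X,Y)\subseteq(X',Y')$ if and only if $X\subseteq X'$ and $Y\subseteq Y'$, with involution $\nu\cdot(X,Y)=(Y,X)$. *)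

theory Defs
  imports Complex_Main "Graph_Theory.Pair_Digraph"
begin

text \<open>
  The ground set may be infinite; only the rank has to be finite.  A uniform bound on the size of
  independent sets makes all maxima below well defined.
\<close>

locale matroid =
  fixes E :: "'a set" and indep :: "'a set \<Rightarrow> bool"
  assumes indep_subset: "indep I \<Longrightarrow> I \<subseteq> E"
    and indep_empty: "indep {}"
    and indep_mono: "indep J \<Longrightarrow> I \<subseteq> J \<Longrightarrow> indep I"
    and augment: "indep I \<Longrightarrow> indep J \<Longrightarrow> card I < card J \<Longrightarrow> \<exists>e\<in>J - I. indep (insert e I)"
    and finite_rank: "\<exists>k. \<forall>I. indep I \<longrightarrow> finite I \<and> card I \<le> k"

definition matroid_rank_of :: "('a set \<Rightarrow> bool) \<Rightarrow> 'a set \<Rightarrow> nat" where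
  "matroid_rank_of indep A = Max (card ` {I. I \<subseteq> A \<and> indep I})"

definition matroid_rank :: "'a set \<Rightarrow> ('a set \<Rightarrow> bool) \<Rightarrow> nat" where
  "matroid_rank E indep = matroid_rank_of indep E"

definition matroid_span :: "'a set \<Rightarrow> ('a set \<Rightarrow> bool) \<Rightarrow> 'a set \<Rightarrow> 'a set" where
  "matroid_span E indep A = {e \<in> E. matroid_rank_of indep (insert e A) = matroid_rank_of indep A}"

definition independent_family :: "('a set \<Rightarrow> bool) \<Rightarrow> ('v \<Rightarrow> 'a) \<Rightarrow> 'v set \<Rightarrow> bool" where
  "independent_family indep x U \<longleftrightarrow> inj_on x U \<and> indep (x ` U)"

context finite_dimensional_vector_space
begin

lemma linear_matroid: "matroid UNIV independent"
proof
  show "\<exists>e\<in>J - I. independent (insert e I)"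
    if "independent I" "independent J" "card I < card J" for I J
  proof -
    have "\<not> J \<subseteq> span I"
      using independent_span_bound[OF finiteI_independent[OF that(1)] that(2)] that(3) by linarith
    then obtain e where "e \<in> J" "e \<notin> span I" by auto
    moreover from this have "e \<notin> I" using span_base by blast
    ultimately show ?thesis
      using independent_insertI[OF _ that(1)] by blast
  qed
  show "\<exists>k. \<forall>I. independent I \<longrightarrow> finite I \<and> card I \<le> k"
    using independent_bound_general independent_card_le_dim[OF subset_UNIV] by blast
qed (simp_all add: independent_empty independent_mono)

lemma matroid_rank_of_linear: "matroid_rank_of independent A = dim A"
proof -
  obtain B where B: "B \<subseteq> A" "independent B" "card B = dim A"
    using basis_exists[of A] by metis
  have le: "card I \<le> dim A" if "I \<subseteq> A" "independent I" for I
    using independent_card_le_dim[OF that] .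
  have "card ` {I. I \<subseteq> A \<and> independent I} \<subseteq> {..dim A}"
    using le by auto
  then have fin: "finite (card ` {I. I \<subseteq> A \<and> independent I})"
    by (rule finite_subset) simp
  have mem: "dim A \<in> card ` {I. I \<subseteq> A \<and> independent I}"
    by (rule image_eqI[of _ _ B]) (simp_all add: B)
  show ?thesis
    unfolding matroid_rank_of_def by (rule Max_eqI[OF fin _ mem]) (use le in auto)
qed

lemma matroid_span_linear: "matroid_span UNIV independent A = span A"
  by (auto simp: matroid_span_def matroid_rank_of_linear dim_insert split: if_splits)

end

record 'a z2_poset =
  elems :: "'a set"
  ord :: "'a rel"
  flip :: "'a \<Rightarrow> 'a"

locale free_z2_poset =
  fixes P :: "'a z2_poset"
  assumes partial_order: "partial_order_on (elems P) (ord P)"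
    and flip_closed: "p \<in> elems P \<Longrightarrow> flip P p \<in> elems P"
    and flip_flip: "p \<in> elems P \<Longrightarrow> flip P (flip P p) = p"
    and flip_neq: "p \<in> elems P \<Longrightarrow> flip P p \<noteq> p"
    and flip_mono: "(p, q) \<in> ord P \<Longrightarrow> (flip P p, flip P q) \<in> ord P"

definition z2_poset_map :: "'a z2_poset \<Rightarrow> 'b z2_poset \<Rightarrow> ('a \<Rightarrow> 'b) \<Rightarrow> bool" where
  "z2_poset_map P Q f \<longleftrightarrow>
     (\<forall>p\<in>elems P. f p \<in> elems Q) \<and>
     (\<forall>p\<in>elems P. \<forall>q\<in>elems P. (p, q) \<in> ord P \<longrightarrow> (f p, f q) \<in> ord Q) \<and>
     (\<forall>p\<in>elems P. f (flip P p) = flip Q (f p))"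

definition cross_poset :: "nat \<Rightarrow> int z2_poset" where
  "cross_poset n =
    \<lparr> elems = {k. k \<noteq> 0 \<and> \<bar>k\<bar> \<le> int n + 1},
      ord = {(p, q). p \<noteq> 0 \<and> \<bar>p\<bar> \<le> int n + 1 \<and> q \<noteq> 0 \<and> \<bar>q\<bar> \<le> int n + 1 \<and>
                     (p = q \<or> \<bar>p\<bar> < \<bar>q\<bar>)},
      flip = uminus \<rparr>"

lemma free_z2_poset_cross_poset: "free_z2_poset (cross_poset n)"
  by unfold_locales
    (auto simp: cross_poset_def partial_order_on_def preorder_on_def refl_on_def trans_def antisym_def)

text \<open>
  The minimum exists for every finite free $Z_2$-poset (lemma \<open>cross_index_exists\<close> below).
\<close>

definition Xind :: "'a z2_poset \<Rightarrow> int" where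
  "Xind P = (if elems P = {} then -1
             else int (LEAST n. \<exists>f. z2_poset_map P (cross_poset n) f))"

lemma (in free_z2_poset) cross_index_exists:
  assumes fin: "finite (elems P)"
  shows "\<exists>n f. z2_poset_map P (cross_poset n) f"
proof -
  have po: "ord P \<subseteq> elems P \<times> elems P" "refl_on (elems P) (ord P)" "trans (ord P)" "antisym (ord P)"
    using partial_order by (auto simp: partial_order_on_def preorder_on_def)
  define D where "D p = {q. (q, p) \<in> ord P}" for p
  define s :: "'a \<Rightarrow> int"
    where "s p = (if p = (SOME r. r \<in> {p, flip P p}) then 1 else -1)" for p
  define f where "f p = s p * int (card (D p))" for p
  have finD: "finite (D p)" for p
    using po(1) fin by (auto simp: D_def intro: finite_subset)
  have memD: "p \<in> D p" if "p \<in> elems P" for p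
    using that po(2) by (auto simp: D_def refl_on_def)
  have pos: "card (D p) > 0" if "p \<in> elems P" for p
    using memD[OF that] finD by (auto simp: card_gt_0_iff)
  have bound: "card (D p) \<le> card (elems P)" for p
    using po(1) fin by (intro card_mono) (auto simp: D_def)
  have abs_s: "\<bar>s p\<bar> = 1" for p by (simp add: s_def)
  have abs_f: "\<bar>f p\<bar> = int (card (D p))" for p by (simp add: f_def abs_mult abs_s)
  have flip_s: "s (flip P p) = - s p" if "p \<in> elems P" for p
  proof -
    have eq: "{flip P p, flip P (flip P p)} = {p, flip P p}" using flip_flip[OF that] by auto
    have "(SOME r. r \<in> {p, flip P p}) \<in> {p, flip P p}" by (rule someI[of _ p]) simp
    then show ?thesis unfolding s_def eq using flip_neq[OF that] by auto
  qed
  have "D (flip P p) = flip P ` D p" if "p \<in> elems P" for p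
  proof
    show "flip P ` D p \<subseteq> D (flip P p)" using flip_mono by (auto simp: D_def)
    show "D (flip P p) \<subseteq> flip P ` D p"
    proof
      fix q assume "q \<in> D (flip P p)"
      then have q: "(q, flip P p) \<in> ord P" by (simp add: D_def)
      then have "(flip P q, p) \<in> ord P" using flip_mono[OF q] flip_flip[OF that] by simp
      moreover have "q = flip P (flip P q)" using q po(1) flip_flip by auto
      ultimately show "q \<in> flip P ` D p" by (auto simp: D_def)
    qed
  qed
  moreover have "inj_on (flip P) (D p)" for p
    using po(1) by (intro inj_on_inverseI[of _ "flip P"]) (auto simp: D_def flip_flip)
  ultimately have flip_D: "card (D (flip P p)) = card (D p)" if "p \<in> elems P" for p
    using that by (simp add: card_image)
  have strict: "card (D p) < card (D q)" if "(p, q) \<in> ord P" "p \<noteq> q" for p q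
  proof (rule psubset_card_mono[OF finD])
    have "D p \<subseteq> D q" using that po(3) by (auto simp: D_def dest: transD)
    moreover have "q \<in> D q" using that po(1) memD by auto
    moreover have "q \<notin> D p" using that po(4) by (auto simp: D_def dest: antisymD)
    ultimately show "D p \<subset> D q" by auto
  qed
  have "z2_poset_map P (cross_poset (card (elems P))) f"
    unfolding z2_poset_map_def
  proof (intro conjI ballI impI)
    fix p assume p: "p \<in> elems P"
    have nz: "f r \<noteq> 0" if "r \<in> elems P" for r
      using abs_f[of r] pos[OF that] by auto
    have le: "\<bar>f r\<bar> \<le> int (card (elems P)) + 1" for r
      using abs_f[of r] bound[of r] by linarith
    show "f p \<in> elems (cross_poset (card (elems P)))"
      using nz[OF p] le by (simp add: cross_poset_def)
    show "f (flip P p) = flip (cross_poset (card (elems P))) (f p)"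
      using flip_D[OF p] flip_s[OF p] by (simp add: cross_poset_def f_def)
    fix q assume q: "q \<in> elems P" and pq: "(p, q) \<in> ord P"
    have "f p = f q \<or> \<bar>f p\<bar> < \<bar>f q\<bar>" using strict[OF pq] abs_f by (cases "p = q") auto
    then show "(f p, f q) \<in> ord (cross_poset (card (elems P)))"
      using nz[OF p] nz[OF q] le by (simp add: cross_poset_def)
  qed
  then show ?thesis by blast
qed

text \<open>
  A finite simple graph is a \<open>pair_graph\<close>, i.e. a finite loopless digraph whose set of arcs is
  symmetric: each edge is represented by both of its orientations.
\<close>

definition hom_K2 :: "'v pair_pre_digraph \<Rightarrow> ('v set \<times> 'v set) z2_poset" where
  "hom_K2 G =
    (let H = {(X, Y). X \<subseteq> pverts G \<and> Y \<subseteq> pverts G \<and> X \<noteq> {} \<and> Y \<noteq> {} \<and> X \<inter> Y = {} \<and>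
                      (\<forall>u\<in>X. \<forall>v\<in>Y. (u, v) \<in> parcs G)}
     in \<lparr> elems = H,
          ord = {(p, q). p \<in> H \<and> q \<in> H \<and> fst p \<subseteq> fst q \<and> snd p \<subseteq> snd q},
          flip = prod.swap \<rparr>)"

lemma elems_hom_K2:
  "(X, Y) \<in> elems (hom_K2 G) \<longleftrightarrow>
     X \<subseteq> pverts G \<and> Y \<subseteq> pverts G \<and> X \<noteq> {} \<and> Y \<noteq> {} \<and> X \<inter> Y = {} \<and>
     (\<forall>u\<in>X. \<forall>v\<in>Y. (u, v) \<in> parcs G)"
  by (simp add: hom_K2_def Let_def)

lemma ord_hom_K2:
  "(p, q) \<in> ord (hom_K2 G) \<longleftrightarrow>
     p \<in> elems (hom_K2 G) \<and> q \<in> elems (hom_K2 G) \<and> fst p \<subseteq> fst q \<and> snd p \<subseteq> snd q"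
  by (simp add: hom_K2_def Let_def)

lemma flip_hom_K2: "flip (hom_K2 G) p = (snd p, fst p)"
  by (simp add: hom_K2_def Let_def prod.swap_def)

lemma (in pair_graph) free_z2_poset_hom_K2: "free_z2_poset (hom_K2 G)"
proof
  have sym_arcs: "(u, v) \<in> parcs G \<Longrightarrow> (v, u) \<in> parcs G" for u v
    using pair_sym_arcs by (simp add: symmetric_def symD)
  show flip: "flip (hom_K2 G) p \<in> elems (hom_K2 G)" if "p \<in> elems (hom_K2 G)" for p
  proof (cases p)
    case (Pair X Y)
    then have "(X, Y) \<in> elems (hom_K2 G)" using that by simp
    then have "(Y, X) \<in> elems (hom_K2 G)"
      unfolding elems_hom_K2 using sym_arcs by (metis Int_commute)
    then show ?thesis by (simp add: flip_hom_K2 Pair)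
  qed
  show "(flip (hom_K2 G) p, flip (hom_K2 G) q) \<in> ord (hom_K2 G)"
    if "(p, q) \<in> ord (hom_K2 G)" for p q
    using that flip[of p] flip[of q] by (simp add: ord_hom_K2 flip_hom_K2)
  show "flip (hom_K2 G) (flip (hom_K2 G) p) = p" for p
    by (simp add: flip_hom_K2)
  show "flip (hom_K2 G) p \<noteq> p" if "p \<in> elems (hom_K2 G)" for p
  proof (cases p)
    case (Pair X Y)
    then have "X \<noteq> {}" "X \<inter> Y = {}" using that by (simp_all add: elems_hom_K2)
    then show ?thesis by (auto simp: flip_hom_K2 Pair)
  qed
  show "partial_order_on (elems (hom_K2 G)) (ord (hom_K2 G))"
    unfolding partial_order_on_def preorder_on_def
  proof (intro conjI)
    show "ord (hom_K2 G) \<subseteq> elems (hom_K2 G) \<times> elems (hom_K2 G)"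
      by (rule subrelI) (simp add: ord_hom_K2)
    show "refl_on (elems (hom_K2 G)) (ord (hom_K2 G))"
      by (simp add: ord_hom_K2 refl_on_def)
    show "trans (ord (hom_K2 G))"
      by (rule transI, unfold ord_hom_K2) (meson subset_trans)
    show "antisym (ord (hom_K2 G))"
      by (rule antisymI, unfold ord_hom_K2) (meson prod_eqI subset_antisym)
  qed
qed

lemma (in pair_graph) finite_hom_K2: "finite (elems (hom_K2 G))"
  by (rule finite_subset[of _ "Pow (pverts G) \<times> Pow (pverts G)"])
    (auto simp: hom_K2_def pair_finite_verts)

definition neighbors :: "'v pair_pre_digraph \<Rightarrow> 'v \<Rightarrow> 'v set" where
  "neighbors G v = {u. (v, u) \<in> parcs G}"

definition independent_representation ::
    "'v pair_pre_digraph \<Rightarrow> 'a set \<Rightarrow> ('a set \<Rightarrow> bool) \<Rightarrow> ('v \<Rightarrow> 'a) \<Rightarrow> bool" where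
  "independent_representation G E indep x \<longleftrightarrow>
     (\<forall>v\<in>pverts G. x v \<in> E \<and> x v \<notin> matroid_span E indep (x ` neighbors G v))"

end

theory Submission
  imports Defs
begin

text \<open>
  For a biclique \<open>(X, Y)\<close> compare the ranks \<open>a\<close> and \<open>b\<close> of the elements assigned to its two sides.
  They are combined into a single height, equal to \<open>2 * min a b\<close> if \<open>a \<noteq> b\<close> and to \<open>2 * a - 1\<close> if
  \<open>a = b\<close>, and the height gets a sign that tells which of the two sides is the smaller one.  The
  point is to have an odd order-preserving map from \<open>Hom(K\<^sub>2, G)\<close> to a cross poset.  Enlarging a
  biclique never lowers its height.  If the height stays at an even value then the smaller side keeps
  its rank and stays the smaller one, so the sign is unchanged.  If it stays at an odd value then
  both ranks are unchanged, and therefore so are the spans of both sides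
  (lemma \<open>span_eq_of_rank_eq\<close>).  The two spans differ, because an element assigned to a vertex of
  \<open>X\<close> is outside the span of the elements of its neighbours, and so outside the span of \<open>Y\<close>; hence in the case of a
  tie the sign can be given by an arbitrary choice from the unordered pair of spans.

  By the definition of the cross-index, some biclique has height at least
  \<open>Xind (hom_K2 G) + 1 = t - 1\<close> (lemma \<open>Xind_less_odd_map\<close>).  The height is designed so that this
  says exactly that one side has rank at least \<open>\<lfloor>t/2\<rfloor>\<close> and the other rank at least \<open>\<lceil>t/2\<rceil>\<close>;
  independent subfamilies of the two sides form the required subgraph.  The rank bound follows since
  the element of a vertex of \<open>X\<close> extends the independent family on \<open>Y\<close>.
\<close>

section \<open>Rank and span in matroids of finite rank\<close>

context matroid
begin

lemma indep_finite: "indep I \<Longrightarrow> finite I"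
  using finite_rank by blast

lemma finite_indep_cards: "finite (card ` {I. I \<subseteq> A \<and> indep I})"
proof -
  obtain k where "\<forall>I. indep I \<longrightarrow> finite I \<and> card I \<le> k" using finite_rank ..
  then have "card ` {I. I \<subseteq> A \<and> indep I} \<subseteq> {..k}" by auto
  then show ?thesis by (rule finite_subset) simp
qed

lemma card_le_rank: "I \<subseteq> A \<Longrightarrow> indep I \<Longrightarrow> card I \<le> matroid_rank_of indep A"
  unfolding matroid_rank_of_def by (intro Max_ge[OF finite_indep_cards]) auto

lemma obtain_basis:
  obtains I where "I \<subseteq> A" "indep I" "card I = matroid_rank_of indep A"
proof -
  have "card ` {I. I \<subseteq> A \<and> indep I} \<noteq> {}" using indep_empty by auto
  from Max_in[OF finite_indep_cards this] that show ?thesis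
    unfolding matroid_rank_of_def by auto
qed

lemma rank_mono: "A \<subseteq> B \<Longrightarrow> matroid_rank_of indep A \<le> matroid_rank_of indep B"
proof -
  assume "A \<subseteq> B"
  moreover obtain I where "I \<subseteq> A" "indep I" "card I = matroid_rank_of indep A"
    by (rule obtain_basis)
  ultimately show ?thesis using card_le_rank[of I B] by auto
qed

lemma obtain_indep_of_card:
  assumes "k \<le> matroid_rank_of indep A"
  obtains I where "I \<subseteq> A" "indep I" "card I = k"
proof -
  obtain J where J: "J \<subseteq> A" "indep J" "card J = matroid_rank_of indep A" by (rule obtain_basis)
  with assms obtain I where "I \<subseteq> J" "card I = k" by (metis obtain_subset_with_card_n)
  with J that show ?thesis using indep_mono by blast
qed

lemma extend_to_basis:
  assumes "indep I" "I \<subseteq> B"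
  shows "\<exists>K. I \<subseteq> K \<and> K \<subseteq> B \<and> indep K \<and> card K = matroid_rank_of indep B"
  using assms
proof (induction "matroid_rank_of indep B - card I" arbitrary: I rule: less_induct)
  case less
  have le: "card I \<le> matroid_rank_of indep B" using less.prems by (intro card_le_rank)
  show ?case
  proof (cases "card I = matroid_rank_of indep B")
    case True
    then show ?thesis using less.prems by blast
  next
    case False
    obtain J where J: "J \<subseteq> B" "indep J" "card J = matroid_rank_of indep B" by (rule obtain_basis)
    then obtain e where e: "e \<in> J - I" "indep (insert e I)"
      using augment[OF less.prems(1) J(2)] le False by auto
    have "card (insert e I) = Suc (card I)" using e(1) indep_finite[OF less.prems(1)] by simp
    then have "matroid_rank_of indep B - card (insert e I) < matroid_rank_of indep B - card I"
      using le False by linarith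
    moreover have "insert e I \<subseteq> B" using e(1) J(1) less.prems(2) by blast
    ultimately have "\<exists>K. insert e I \<subseteq> K \<and> K \<subseteq> B \<and> indep K \<and> card K = matroid_rank_of indep B"
      by (intro less.hyps e(2))
    then show ?thesis by blast
  qed
qed

text \<open>
  The span is determined by a single basis; this is why it does not change when the set grows at
  constant rank.
\<close>

lemma mem_span_iff_basis:
  assumes I: "I \<subseteq> A" "indep I" "card I = matroid_rank_of indep A"
  shows "e \<in> matroid_span E indep A \<longleftrightarrow> e \<in> E \<and> (e \<in> I \<or> \<not> indep (insert e I))"
proof -
  have le: "matroid_rank_of indep A \<le> matroid_rank_of indep (insert e A)"
    by (rule rank_mono) blast
  have "matroid_rank_of indep (insert e A) \<noteq> matroid_rank_of indep A" if "e \<notin> I" "indep (insert e I)"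
    using card_le_rank[OF insert_mono[OF I(1)] that(2)] that(1) I(3) indep_finite[OF I(2)] by simp
  moreover have "e \<notin> I \<and> indep (insert e I)"
    if neq: "matroid_rank_of indep (insert e A) \<noteq> matroid_rank_of indep A"
  proof -
    obtain J where J: "J \<subseteq> insert e A" "indep J" "card J = matroid_rank_of indep (insert e A)"
      by (rule obtain_basis)
    then obtain d where d: "d \<in> J - I" "indep (insert d I)"
      using augment[OF I(2) J(2)] I(3) le neq by auto
    have "\<not> insert d I \<subseteq> A"
      using card_le_rank[of "insert d I" A] d I indep_finite[OF I(2)] by auto
    then have "d = e" using d(1) J(1) I(1) by blast
    then show ?thesis using d by blast
  qed
  ultimately show ?thesis unfolding matroid_span_def by blast
qed

lemma span_eq_of_rank_eq:
  assumes "A \<subseteq> B" "matroid_rank_of indep A = matroid_rank_of indep B"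
  shows "matroid_span E indep A = matroid_span E indep B"
proof -
  obtain I where I: "I \<subseteq> A" "indep I" "card I = matroid_rank_of indep A" by (rule obtain_basis)
  moreover have "I \<subseteq> B" "card I = matroid_rank_of indep B" using I assms by auto
  ultimately show ?thesis using mem_span_iff_basis by blast
qed

lemma span_mono:
  assumes "A \<subseteq> B"
  shows "matroid_span E indep A \<subseteq> matroid_span E indep B"
proof -
  obtain I where I: "I \<subseteq> A" "indep I" "card I = matroid_rank_of indep A" by (rule obtain_basis)
  then obtain K where K: "I \<subseteq> K" "K \<subseteq> B" "indep K" "card K = matroid_rank_of indep B"
    using extend_to_basis[of I B] assms by blast
  show ?thesis
  proof
    fix e assume "e \<in> matroid_span E indep A"
    then have "e \<in> E" "e \<in> I \<or> \<not> indep (insert e I)"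
      using mem_span_iff_basis[OF I] by auto
    moreover have "indep (insert e I)" if "indep (insert e K)"
      using indep_mono[OF that insert_mono[OF K(1)]] .
    ultimately show "e \<in> matroid_span E indep B"
      using mem_span_iff_basis[OF K(2-4)] K(1) by blast
  qed
qed

lemma mem_span_self: "e \<in> A \<Longrightarrow> e \<in> E \<Longrightarrow> e \<in> matroid_span E indep A"
  by (simp add: matroid_span_def insert_absorb)

lemma indep_insert_of_notin_span:
  assumes "indep I" "e \<in> E" "e \<notin> matroid_span E indep I"
  shows "e \<notin> I" "indep (insert e I)"
proof -
  obtain J where "J \<subseteq> I" "indep J" "card J = matroid_rank_of indep I" by (rule obtain_basis)
  then have "card I = matroid_rank_of indep I"
    using card_le_rank[OF subset_refl assms(1)] card_mono[OF indep_finite[OF assms(1)]]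
    by (metis le_antisym)
  from mem_span_iff_basis[OF subset_refl assms(1) this] assms(2,3)
  show "e \<notin> I" "indep (insert e I)" by blast+
qed

lemma independent_subfamily:
  assumes "k \<le> matroid_rank_of indep (x ` U)"
  obtains W where "W \<subseteq> U" "card W = k" "independent_family indep x W"
proof -
  obtain I where I: "I \<subseteq> x ` U" "indep I" "card I = k"
    by (rule obtain_indep_of_card[OF assms])
  then obtain W where "W \<subseteq> U" "inj_on x W" "I = x ` W" by (metis subset_image_inj)
  with I have "card W = k" "independent_family indep x W"
    by (auto simp: card_image independent_family_def)
  with \<open>W \<subseteq> U\<close> that show ?thesis by blast
qed

end

section \<open>The signed height of a pair of flats\<close>

text \<open>
  The largest absolute value \<open>m\<close> attained by \<open>f\<close> makes \<open>f\<close> itself an order-preserving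
  \<open>Z\<^sub>2\<close>-map into \<open>cross_poset (m - 1)\<close>, so the cross-index is at most \<open>m - 1\<close>.
\<close>

lemma Xind_less_odd_map:
  fixes f :: "'p \<Rightarrow> int"
  assumes fin: "finite (elems P)" and ne: "elems P \<noteq> {}"
    and nz: "\<And>p. p \<in> elems P \<Longrightarrow> f p \<noteq> 0"
    and mono: "\<And>p q. p \<in> elems P \<Longrightarrow> q \<in> elems P \<Longrightarrow> (p, q) \<in> ord P \<Longrightarrow> f p = f q \<or> \<bar>f p\<bar> < \<bar>f q\<bar>"
    and odd: "\<And>p. p \<in> elems P \<Longrightarrow> f (flip P p) = - f p"
  obtains p where "p \<in> elems P" "Xind P < \<bar>f p\<bar>"
proof -
  define m where "m = Max ((\<lambda>p. \<bar>f p\<bar>) ` elems P)"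
  have "m \<in> (\<lambda>p. \<bar>f p\<bar>) ` elems P" unfolding m_def using fin ne by (intro Max_in) auto
  then obtain p where p: "p \<in> elems P" "\<bar>f p\<bar> = m" by auto
  have le: "\<bar>f q\<bar> \<le> m" if "q \<in> elems P" for q unfolding m_def using fin that by (intro Max_ge) auto
  have m: "m \<ge> 1" using nz[OF p(1)] p(2) by linarith
  have "z2_poset_map P (cross_poset (nat (m - 1))) f"
    unfolding z2_poset_map_def using m le nz mono odd by (auto simp: cross_poset_def)
  then have "(LEAST n. \<exists>f. z2_poset_map P (cross_poset n) f) \<le> nat (m - 1)"
    by (intro Least_le) blast
  then have "Xind P < m" using ne m by (simp add: Xind_def)
  with p that show ?thesis by simp
qed

text \<open>
  Every equality \<open>a = b = k\<close> gets a level of its own, just below the level \<open>2 * k\<close> of the pairs with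
  minimum \<open>k\<close> and \<open>a \<noteq> b\<close>.  Thus on no level can a pair become tied, or cease to be tied, when its
  ranks grow.
\<close>

definition pair_height :: "nat \<Rightarrow> nat \<Rightarrow> int" where
  "pair_height a b = (if a = b then 2 * int a - 1 else 2 * int (min a b))"

text \<open>
  The first two arguments are the ranks of the flats \<open>A\<close> and \<open>B\<close>.  The choice operator sees only the
  unordered pair \<open>{A, B}\<close>, which makes the sign antisymmetric for distinct flats of equal rank.
\<close>

definition pair_sign :: "nat \<Rightarrow> nat \<Rightarrow> 'a set \<Rightarrow> 'a set \<Rightarrow> int" where
  "pair_sign a b A B =
    (if a < b then 1 else if b < a then -1 else if A = (SOME C. C \<in> {A, B}) then 1 else -1)"

lemma abs_pair_sign: "\<bar>pair_sign a b A B\<bar> = 1"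
  by (simp add: pair_sign_def)

lemma pair_sign_swap:
  assumes "A \<noteq> B"
  shows "pair_sign b a B A = - pair_sign a b A B"
proof -
  have "(SOME C. C \<in> {A, B}) \<in> {A, B}" by (rule someI[of _ A]) simp
  moreover have "{B, A} = {A, B}" by blast
  ultimately show ?thesis using assms unfolding pair_sign_def by auto
qed

lemma pair_height_swap: "pair_height b a = pair_height a b"
  by (auto simp: pair_height_def)

lemma pair_height_mono:
  assumes "a \<le> a'" "b \<le> b'"
  shows "pair_height a b \<le> pair_height a' b'"
  using assms by (auto simp: pair_height_def min_def)

text \<open>
  This is what makes the signed height a map into a cross poset, where distinct elements of the same
  absolute value are incomparable: along a growing pair the sign may change only if the height does.
\<close>

lemma pair_sign_const:
  assumes "a \<le> a'" "b \<le> b'" and height: "pair_height a b = pair_height a' b'"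
    and "a = a' \<Longrightarrow> A = A'" "b = b' \<Longrightarrow> B = B'"
  shows "pair_sign a b A B = pair_sign a' b' A' B'"
proof (cases "a = b")
  case True
  \<comment> \<open>An odd height is attained only by equal ranks, so neither of the two ranks has grown.\<close>
  then have "a' = b'" using height by (auto simp: pair_height_def split: if_splits; presburger)
  then have "a = a'" "b = b'" using True height by (auto simp: pair_height_def)
  then show ?thesis using assms by simp
next
  case False
  \<comment> \<open>The smaller rank is unchanged while the larger one has not dropped, so they keep their order.\<close>
  then have "a' \<noteq> b'" using height by (auto simp: pair_height_def split: if_splits; presburger)
  then have "min a b = min a' b'" using False height by (auto simp: pair_height_def)
  then have "a < b \<longleftrightarrow> a' < b'" using assms(1,2) False \<open>a' \<noteq> b'\<close> by (auto simp: min_def split: if_splits)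
  then show ?thesis using False \<open>a' \<noteq> b'\<close> by (auto simp: pair_sign_def)
qed

section \<open>Bicliques of an independent representation\<close>

lemma notin_span_opposite_side:
  assumes "matroid E indep" "independent_representation G E indep x"
    and "v \<in> pverts G" "\<forall>u\<in>Y. (v, u) \<in> parcs G"
  shows "x v \<in> E" "x v \<notin> matroid_span E indep (x ` Y)"
proof -
  interpret matroid E indep by fact
  have "x ` Y \<subseteq> x ` neighbors G v" using assms(4) by (auto simp: neighbors_def)
  then show "x v \<in> E" "x v \<notin> matroid_span E indep (x ` Y)"
    using assms(2,3) span_mono unfolding independent_representation_def by blast+
qed

text \<open>
  The signed height of the ranks and spans of both sides is an odd order-preserving map on
  \<open>hom_K2 G\<close>: rank and span grow with a side, and the span is constant where the rank is.
\<close>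

lemma biclique_of_large_height:
  assumes graph: "pair_graph G" and edge: "parcs G \<noteq> {}"
    and matroid: "matroid E indep"
    and rep: "independent_representation G E indep x"
  obtains X Y where "(X, Y) \<in> elems (hom_K2 G)"
    "Xind (hom_K2 G) < pair_height (matroid_rank_of indep (x ` X)) (matroid_rank_of indep (x ` Y))"
proof -
  interpret pair_graph G by fact
  interpret matroid E indep by fact
  interpret free_z2_poset "hom_K2 G" by (rule free_z2_poset_hom_K2)
  define r where "r X = matroid_rank_of indep (x ` X)" for X
  define s where "s X = matroid_span E indep (x ` X)" for X
  define f where "f p = pair_sign (r (fst p)) (r (snd p)) (s (fst p)) (s (snd p))
      * pair_height (r (fst p)) (r (snd p))" for p
  have flip_mem: "(Y, X) \<in> elems (hom_K2 G)" if "(X, Y) \<in> elems (hom_K2 G)" for X Y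
    using flip_closed[OF that] by (simp add: flip_hom_K2)
  have sides: "r X > 0 \<and> s X \<noteq> s Y" if XY: "(X, Y) \<in> elems (hom_K2 G)" for X Y
  proof -
    obtain v where v: "v \<in> X" "v \<in> pverts G" "\<forall>u\<in>Y. (v, u) \<in> parcs G"
      using XY unfolding elems_hom_K2 by blast
    note xv = notin_span_opposite_side[OF matroid rep v(2,3)]
    \<comment> \<open>The element \<open>x v\<close> is not a loop, since loops belong to every span.\<close>
    have "x v \<notin> matroid_span E indep {}" using xv(2) span_mono[of "{}"] by blast
    then have "indep {x v}" using indep_insert_of_notin_span(2)[OF indep_empty xv(1)] by simp
    then have "r X > 0" using card_le_rank[of "{x v}" "x ` X"] v(1) by (simp add: r_def)
    moreover have "x v \<in> s X" using mem_span_self[OF _ xv(1)] v(1) by (simp add: s_def)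
    ultimately show ?thesis using xv(2) by (auto simp: s_def)
  qed
  have height_pos: "pair_height (r X) (r Y) > 0" if "(X, Y) \<in> elems (hom_K2 G)" for X Y
    using sides[OF that] sides[OF flip_mem[OF that]] by (auto simp: pair_height_def)
  have abs_f: "\<bar>f (X, Y)\<bar> = pair_height (r X) (r Y)" if "(X, Y) \<in> elems (hom_K2 G)" for X Y
    using height_pos[OF that] by (simp add: f_def abs_mult abs_pair_sign)
  obtain u v where "(u, v) \<in> parcs G" using edge by auto
  then have "({u}, {v}) \<in> elems (hom_K2 G)"
    unfolding elems_hom_K2 using pair_no_loops[of "(u, v)"] in_arcsD1 in_arcsD2 by auto
  then have ne: "elems (hom_K2 G) \<noteq> {}" by blast
  have mono: "f p = f q \<or> \<bar>f p\<bar> < \<bar>f q\<bar>" if pq: "(p, q) \<in> ord (hom_K2 G)" for p q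
  proof -
    obtain X Y X' Y' where eq: "p = (X, Y)" "q = (X', Y')" by (cases p, cases q)
    have mem: "(X, Y) \<in> elems (hom_K2 G)" "(X', Y') \<in> elems (hom_K2 G)"
      and sub: "X \<subseteq> X'" "Y \<subseteq> Y'"
      using pq unfolding ord_hom_K2 eq by auto
    have le: "r X \<le> r X'" "r Y \<le> r Y'"
      unfolding r_def using sub by (auto intro!: rank_mono)
    have span: "r X = r X' \<Longrightarrow> s X = s X'" "r Y = r Y' \<Longrightarrow> s Y = s Y'"
      unfolding r_def s_def using sub by (auto intro!: span_eq_of_rank_eq del: equalityI)
    show ?thesis
    proof (cases "pair_height (r X) (r Y) = pair_height (r X') (r Y')")
      case True
      from pair_sign_const[OF le this span] True show ?thesis by (simp add: f_def eq)
    next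
      case False
      with pair_height_mono[OF le] show ?thesis by (simp add: abs_f mem eq)
    qed
  qed
  have nonzero: "f p \<noteq> 0" if "p \<in> elems (hom_K2 G)" for p
    using abs_f[of "fst p" "snd p"] height_pos[of "fst p" "snd p"] that by auto
  have odd: "f (flip (hom_K2 G) p) = - f p" if "p \<in> elems (hom_K2 G)" for p
    using sides[of "fst p" "snd p"] that
    by (simp add: f_def flip_hom_K2 pair_height_swap[of "r (snd p)"] pair_sign_swap)
  obtain p where "p \<in> elems (hom_K2 G)" "Xind (hom_K2 G) < \<bar>f p\<bar>"
    using Xind_less_odd_map[of "hom_K2 G" f] finite_hom_K2 ne mono nonzero odd by metis
  then show ?thesis using that[of "fst p" "snd p"] abs_f[of "fst p" "snd p"] by (simp add: r_def)
qed

theorem theorem1: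
  fixes G :: "'v pair_pre_digraph"
    and E :: "'a set" and indep :: "'a set \<Rightarrow> bool"
    and x :: "'v \<Rightarrow> 'a"
    and t :: int
  assumes graph: "pair_graph G" and edge: "parcs G \<noteq> {}"
    and t: "t = Xind (hom_K2 G) + 2"
    and matroid: "matroid E indep"
    and rep: "independent_representation G E indep x"
  shows "(\<exists>X Y. X \<subseteq> pverts G \<and> Y \<subseteq> pverts G \<and> X \<inter> Y = {} \<and>
            int (card X) = \<lfloor>real_of_int t / 2\<rfloor> \<and> int (card Y) = \<lceil>real_of_int t / 2\<rceil> \<and>
            (\<forall>u\<in>X. \<forall>v\<in>Y. (u, v) \<in> parcs G) \<and>
            independent_family indep x X \<and> independent_family indep x Y)
       \<and> real (matroid_rank E indep) \<ge> 1 / 2 * real_of_int (Xind (hom_K2 G)) + 2"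
proof -
  interpret pair_graph G by fact
  interpret matroid E indep by fact
  have sym_arcs: "(v, u) \<in> parcs G" if "(u, v) \<in> parcs G" for u v
    using that pair_sym_arcs by (simp add: symmetric_def symD)
  define r where "r X = matroid_rank_of indep (x ` X)" for X
  obtain X0 Y0 where mem0: "(X0, Y0) \<in> elems (hom_K2 G)"
    and height0: "Xind (hom_K2 G) < pair_height (r X0) (r Y0)"
    unfolding r_def by (rule biclique_of_large_height[OF graph edge matroid rep])
  have "(Y0, X0) \<in> elems (hom_K2 G)"
    using free_z2_poset.flip_closed[OF free_z2_poset_hom_K2 mem0] by (simp add: flip_hom_K2)
  then obtain X Y where mem: "(X, Y) \<in> elems (hom_K2 G)" and "r X \<le> r Y"
    and height: "Xind (hom_K2 G) < pair_height (r X) (r Y)"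
    using mem0 height0 pair_height_swap[of "r X0" "r Y0"] by (metis linear)
  have XY: "X \<subseteq> pverts G" "Y \<subseteq> pverts G" "X \<inter> Y = {}" "\<forall>u\<in>X. \<forall>v\<in>Y. (u, v) \<in> parcs G"
    using mem unfolding elems_hom_K2 by auto
  have "elems (hom_K2 G) \<noteq> {}" using mem by blast
  then have "t \<ge> 2" using t by (simp add: Xind_def)
  define m n where "m = nat (t div 2)" and "n = nat ((t + 1) div 2)"
  have int_mn: "int m = t div 2" "int n = (t + 1) div 2" and "m > 0"
    using \<open>t \<ge> 2\<close> by (auto simp: m_def n_def)
  have floor_t: "\<lfloor>real_of_int t / 2\<rfloor> = int m"
    using int_mn(1) by linarith
  have ceiling_t: "\<lceil>real_of_int t / 2\<rceil> = int n"
    using int_mn(2) by linarith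
  \<comment> \<open>The height is at least \<open>t - 1\<close>.  For \<open>t = 2 * m\<close> this forces the smaller rank to be at least
    \<open>m\<close>; for \<open>t = 2 * m + 1\<close> the height \<open>2 * m - 1\<close> of two ranks equal to \<open>m\<close> is too small as well.\<close>
  have "m \<le> r X" "n \<le> r Y"
    using height \<open>r X \<le> r Y\<close> int_mn t
    by (auto simp: pair_height_def min_def split: if_splits)
  obtain X' where X': "X' \<subseteq> X" "card X' = m" "independent_family indep x X'"
    using independent_subfamily[of m x X] \<open>m \<le> r X\<close> unfolding r_def by blast
  obtain Y' where Y': "Y' \<subseteq> Y" "card Y' = n" "independent_family indep x Y'"
    using independent_subfamily[of n x Y] \<open>n \<le> r Y\<close> unfolding r_def by blast
  have "X' \<noteq> {}" using X'(2) \<open>m > 0\<close> by auto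
  then obtain v where v: "v \<in> pverts G" "\<forall>u\<in>Y'. (v, u) \<in> parcs G"
    using XY X'(1) Y'(1) by blast
  note xv = notin_span_opposite_side[OF matroid rep v]
  have indep_Y': "indep (x ` Y')" and card_Y': "card (x ` Y') = n"
    using Y' by (auto simp: independent_family_def card_image)
  note ins = indep_insert_of_notin_span[OF indep_Y' xv]
  have "n + 1 = card (insert (x v) (x ` Y'))"
    using ins(1) card_Y' indep_finite[OF indep_Y'] by simp
  also have "\<dots> \<le> matroid_rank E indep"
    unfolding matroid_rank_def using card_le_rank[OF indep_subset[OF ins(2)] ins(2)] .
  finally have "real (matroid_rank E indep) \<ge> real n + 1" by linarith
  moreover have "real n \<ge> real_of_int t / 2" using ceiling_t by linarith
  ultimately have "real (matroid_rank E indep) \<ge> 1 / 2 * real_of_int (Xind (hom_K2 G)) + 2"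
    using t by simp
  moreover have "X' \<subseteq> pverts G \<and> Y' \<subseteq> pverts G \<and> X' \<inter> Y' = {} \<and>
      (\<forall>u\<in>X'. \<forall>v\<in>Y'. (u, v) \<in> parcs G)"
    using XY X'(1) Y'(1) by blast
  ultimately show ?thesis
    using X'(2,3) Y'(2,3) floor_t ceiling_t by auto
qed

end
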